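(* Let $n\ge1$, let $a=v_0<v_1<\dots<v_n=b$, let $\zeta_i\in(v_i,v_{i+1})$ for $0\le i\le n-1$, and let $\varphi(i)\ge 2$ be integers for $0\le i\le n$. Then the B-spline-like functions $\mathcal{N}_{i,\alpha}$, $0\le i\le n$, $|\alpha|=\varphi(i)-1$, form a partition of unity on $[a,b]$, i.e. $$\sum_{i=0}^{n}\ \sum_{|\alpha|=\varphi(i)-1}\mathcal{N}_{i,\alpha}(v)=1\qquad\text{for all } v\in[a,b].$$
   Context: Put $\zeta_{-1}=v_0$, $\zeta_n=v_n$. $\mathbb{P}_d$ is the space of real polynomials of degree $\le d$. The space $\mathcal{S}^1(\varphi,\overline{\tau}_n)$ consists of all functions $s:[a,b]\to\mathbb{R}$ such that: (i) for each $0\le i\le n$, the restrictions of $s$ to $[\zeta_{i-1},v_i]$ and to $[v_i,\zeta_i]$ (when non-degenerate) are in $\mathbb{P}_{\varphi(i)}$; (ii) $s$ is $\mathcal{C}^{\varphi(i)-1}$ at $v_i$ for $0<i<n$; (iii) $s$ is $\mathcal{C}^1$ at $\zeta_i$ for $0\le i\le n-1$ ("$\mathcal{C}^r$ at a point" means that the derivatives of orders $0,\dots,r$ of the two adjacent polynomial pieces agree there). A function $s\in\mathcal{S}^1(\varphi,\overline{\tau}_n)$ exists and is unique with arbitrarily prescribed values $s^{(j)}(v_i)$, $0\le i\le n$, $0\le j\le\varphi(i)-1$ (one-sided derivatives at $a$, $b$). For a multi-index $\alpha=(\alpha_1,\alpha_2)\in\mathbb{Z}_{\ge0}^2$ with $|\alpha|=\alpha_1+\alpha_2=d$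 and an interval $[A,B]$, the Bernstein polynomial is $\mathfrak{B}^d_{\alpha,[A,B]}(v)=\frac{d!}{\alpha_1!\alpha_2!}\frac{(B-v)^{\alpha_1}(v-A)^{\alpha_2}}{(B-A)^d}$. For $0\le i\le n$ let $\theta_i=\frac{\varphi(i)-1}{\varphi(i)}$, $S_{i,1}=\theta_i\zeta_{i-1}+(1-\theta_i)v_i$, $S_{i,2}=\theta_i\zeta_i+(1-\theta_i)v_i$, and $S_i=[S_{i,1},S_{i,2}]$ (so $S_{0,1}=v_0$ and $S_{n,2}=v_n$). For $|\alpha|=\varphi(i)-1$ and $0\le j\le\varphi(i)-1$ set $$\gamma_{i,\alpha}^j=\frac{\binom{\varphi(i)}{j}}{\binom{\varphi(i)-1}{j}}\,\theta_i^j\,\bigl(\mathfrak{B}^{\varphi(i)-1}_{\alpha,S_i}\bigr)^{(j)}(v_i).$$ The B-spline-like function $\mathcal{N}_{i,\alpha}$ is the unique element of $\mathcal{S}^1(\varphi,\overline{\tau}_n)$ with $\mathcal{N}_{i,\alpha}^{(j)}(v_i)=\gamma_{i,\alpha}^j$ for $0\le j\le\varphi(i)-1$ and $\mathcal{N}_{i,\alpha}^{(j)}(v_k)=0$ for $k\ne i$, $0\le j\le\varphi(k)-1$. *)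

theory Defs
  imports "HOL-Analysis.Analysis" "HOL-Computational_Algebra.Polynomial"
begin

text \<open>
  Parameters throughout: the number \<open>n\<close>, the vertices \<open>v 0 < \<dots> < v n\<close>, the split points \<open>\<zeta> i\<close>
  for \<open>i < n\<close>, and the degrees \<open>\<phi> i\<close> for \<open>i \<le> n\<close>.  Values of \<open>v\<close>, \<open>\<zeta>\<close>, \<open>\<phi>\<close> at other
  indices are irrelevant.
\<close>

text \<open>The split points with the boundary convention \<open>\<zeta>(-1) = v 0\<close> and \<open>\<zeta>(n) = v n\<close>.\<close>

definition split_pt :: "nat \<Rightarrow> (nat \<Rightarrow> real) \<Rightarrow> (nat \<Rightarrow> real) \<Rightarrow> int \<Rightarrow> real" where
  "split_pt n v \<zeta> k = (if k < 0 then v 0 else if k \<ge> int n then v n else \<zeta> (nat k))"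

text \<open>
  Functions on \<open>[a,b] = {v 0..v n}\<close> are represented by extensional functions, so that an element is
  determined by its values on \<open>[a,b]\<close>.  The polynomials \<open>L i\<close> and \<open>R i\<close> are the pieces of \<open>s\<close> to the
  left and to the right of \<open>v i\<close>.  The degenerate intervals (left of \<open>v 0\<close>, right of \<open>v n\<close>) carry
  no condition; on all others the pieces are determined by \<open>s\<close>.
\<close>

definition spline_space ::
  "nat \<Rightarrow> (nat \<Rightarrow> real) \<Rightarrow> (nat \<Rightarrow> real) \<Rightarrow> (nat \<Rightarrow> nat) \<Rightarrow> (real \<Rightarrow> real) set" where
  "spline_space n v \<zeta> \<phi> = {s \<in> extensional {v 0..v n}. \<exists>L R :: nat \<Rightarrow> real poly.
     (\<forall>i. 0 < i \<and> i \<le> n \<longrightarrow> degree (L i) \<le> \<phi> i \<and>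
        (\<forall>x \<in> {split_pt n v \<zeta> (int i - 1)..v i}. s x = poly (L i) x)) \<and>
     (\<forall>i. i < n \<longrightarrow> degree (R i) \<le> \<phi> i \<and>
        (\<forall>x \<in> {v i..split_pt n v \<zeta> (int i)}. s x = poly (R i) x)) \<and>
     (\<forall>i. 0 < i \<and> i < n \<longrightarrow> (\<forall>j \<le> \<phi> i - 1.
        poly ((pderiv ^^ j) (L i)) (v i) = poly ((pderiv ^^ j) (R i)) (v i))) \<and>
     (\<forall>i. i < n \<longrightarrow> (\<forall>j \<le> 1.
        poly ((pderiv ^^ j) (R i)) (split_pt n v \<zeta> (int i)) =
        poly ((pderiv ^^ j) (L (Suc i))) (split_pt n v \<zeta> (int i))))}"

text \<open>
  Iterated derivative relative to a set; for \<open>A = {a..b}\<close> it is the two-sided derivative in the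
  interior and the one-sided derivative at \<open>a\<close> and \<open>b\<close>.
\<close>

primrec nderiv_on :: "real set \<Rightarrow> nat \<Rightarrow> (real \<Rightarrow> real) \<Rightarrow> real \<Rightarrow> real" where
  "nderiv_on A 0 f = f"
| "nderiv_on A (Suc j) f = (\<lambda>x. vector_derivative (nderiv_on A j f) (at x within A))"

definition bernstein_poly :: "nat \<times> nat \<Rightarrow> real \<Rightarrow> real \<Rightarrow> real \<Rightarrow> real" where
  "bernstein_poly \<alpha> A B x =
     fact (fst \<alpha> + snd \<alpha>) / (fact (fst \<alpha>) * fact (snd \<alpha>)) *
     ((B - x) ^ fst \<alpha> * (x - A) ^ snd \<alpha> / (B - A) ^ (fst \<alpha> + snd \<alpha>))"

definition theta :: "(nat \<Rightarrow> nat) \<Rightarrow> nat \<Rightarrow> real" where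
  "theta \<phi> i = (real (\<phi> i) - 1) / real (\<phi> i)"

definition S_left ::
  "nat \<Rightarrow> (nat \<Rightarrow> real) \<Rightarrow> (nat \<Rightarrow> real) \<Rightarrow> (nat \<Rightarrow> nat) \<Rightarrow> nat \<Rightarrow> real" where
  "S_left n v \<zeta> \<phi> i = theta \<phi> i * split_pt n v \<zeta> (int i - 1) + (1 - theta \<phi> i) * v i"

definition S_right ::
  "nat \<Rightarrow> (nat \<Rightarrow> real) \<Rightarrow> (nat \<Rightarrow> real) \<Rightarrow> (nat \<Rightarrow> nat) \<Rightarrow> nat \<Rightarrow> real" where
  "S_right n v \<zeta> \<phi> i = theta \<phi> i * split_pt n v \<zeta> (int i) + (1 - theta \<phi> i) * v i"

definition gamma_coeff ::
  "nat \<Rightarrow> (nat \<Rightarrow> real) \<Rightarrow> (nat \<Rightarrow> real) \<Rightarrow> (nat \<Rightarrow> nat) \<Rightarrow> nat \<Rightarrow> nat \<times> nat \<Rightarrow> nat \<Rightarrow> real" where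
  "gamma_coeff n v \<zeta> \<phi> i \<alpha> j =
     real (\<phi> i choose j) / real ((\<phi> i - 1) choose j) * theta \<phi> i ^ j *
     (deriv ^^ j) (bernstein_poly \<alpha> (S_left n v \<zeta> \<phi> i) (S_right n v \<zeta> \<phi> i)) (v i)"

definition Nspline ::
  "nat \<Rightarrow> (nat \<Rightarrow> real) \<Rightarrow> (nat \<Rightarrow> real) \<Rightarrow> (nat \<Rightarrow> nat) \<Rightarrow> nat \<Rightarrow> nat \<times> nat \<Rightarrow> real \<Rightarrow> real" where
  "Nspline n v \<zeta> \<phi> i \<alpha> = (THE s. s \<in> spline_space n v \<zeta> \<phi> \<and>
     (\<forall>j \<le> \<phi> i - 1. nderiv_on {v 0..v n} j s (v i) = gamma_coeff n v \<zeta> \<phi> i \<alpha> j) \<and>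
     (\<forall>k \<le> n. k \<noteq> i \<longrightarrow> (\<forall>j \<le> \<phi> k - 1. nderiv_on {v 0..v n} j s (v k) = 0)))"

end

theory Submission imports Defs begin

text \<open>
  On \<open>[v i, v (i+1)]\<close> a spline is a pair of polynomials joined at \<open>\<zeta> i\<close>.  The data at \<open>v i\<close> fix the
  left one up to a multiple of \<open>(x - v i) ^ \<phi> i\<close>, those at \<open>v (i+1)\<close> fix the right one up to a multiple
  of \<open>(x - v (i+1)) ^ \<phi> (i+1)\<close>, and the \<open>C\<^sup>1\<close> condition at \<open>\<zeta> i\<close> is a regular \<open>2 \<times> 2\<close> linear system for
  the two multiples.  So a spline is determined by its data, linearly.  Since the Bernstein
  polynomials of a fixed degree sum to 1, the numbers \<open>\<gamma>\<close> at a fixed \<open>v i\<close> sum to 1 for \<open>j = 0\<close> and to 0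
  for \<open>j > 0\<close>, which are the data of the constant 1.
\<close>

subsection \<open>Two-point Hermite interpolation with a split point\<close>

text \<open>Leibniz's rule has only two terms here, because the second derivative of the linear
  factor vanishes.\<close>

lemma higher_pderiv_linear_mult:
  fixes q :: "real poly"
  shows "(pderiv ^^ Suc j) ([:-c, 1:] * q) =
    [:-c, 1:] * (pderiv ^^ Suc j) q + smult (of_nat (Suc j)) ((pderiv ^^ j) q)"
proof (induction j)
  have "pderiv [:-c, 1:] = 1" by (simp add: pderiv_pCons)
  then have step: "pderiv ([:-c, 1:] * r) = [:-c, 1:] * pderiv r + r" for r
    by (simp add: pderiv_mult del: mult_pCons_left)
  {
    case 0
    show ?case using step[of q] by (simp del: mult_pCons_left)
  next
    case (Suc j)
    have "(pderiv ^^ Suc (Suc j)) ([:-c, 1:] * q) =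
      pderiv ([:-c, 1:] * (pderiv ^^ Suc j) q + smult (of_nat (Suc j)) ((pderiv ^^ j) q))"
      using Suc.IH by simp
    also have "\<dots> = [:-c, 1:] * (pderiv ^^ Suc (Suc j)) q + (pderiv ^^ Suc j) q
        + smult (of_nat (Suc j)) ((pderiv ^^ Suc j) q)"
      unfolding pderiv_add step pderiv_smult by simp
    also have "\<dots> = [:-c, 1:] * (pderiv ^^ Suc (Suc j)) q + smult (of_nat (Suc (Suc j))) ((pderiv ^^ Suc j) q)"
      by (simp only: of_nat_Suc[of "Suc j"] smult_add_left smult_1_left add.assoc)
    finally show ?case .
  }
qed

text \<open>At \<open>c\<close> the term with the factor \<open>x - c\<close> drops out. So
  multiplication by \<open>x - c\<close> shifts the derivative data at \<open>c\<close> by one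
  order, which drives the inductions of the next three lemmas.\<close>

lemma poly_higher_pderiv_linear_mult:
  fixes q :: "real poly"
  shows "poly ((pderiv ^^ Suc j) ([:-c, 1:] * q)) c = of_nat (Suc j) * poly ((pderiv ^^ j) q) c"
  unfolding higher_pderiv_linear_mult by simp

lemma poly_higher_pderiv_linear_power:
  fixes c :: real
  shows "j < m \<Longrightarrow> poly ((pderiv ^^ j) ([:-c, 1:] ^ m)) c = 0"
proof (induction m arbitrary: j)
  case (Suc m)
  show ?case
  proof (cases j)
    case (Suc k)
    have "poly ((pderiv ^^ Suc k) ([:-c, 1:] * [:-c, 1:] ^ m)) c = 0"
      unfolding poly_higher_pderiv_linear_mult using Suc.IH[of k] Suc.prems Suc by simp
    then show ?thesis using Suc by simp
  qed simp
qed simp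

text \<open>Each induction step divides out one factor \<open>x - c\<close>: the degree drops by
  one, and the quotient inherits the vanishing derivatives one order lower.\<close>

lemma vanishing_derivs_imp_linear_power:
  fixes p :: "real poly"
  assumes "degree p \<le> m" and "\<And>j. j < m \<Longrightarrow> poly ((pderiv ^^ j) p) c = 0"
  shows "\<exists>e. p = smult e ([:-c, 1:] ^ m)"
  using assms
proof (induction m arbitrary: p)
  case 0
  then obtain e where "p = [:e:]" by (metis degree_eq_zeroE le_zero_eq)
  then show ?case by (intro exI[of _ e]) simp
next
  case (Suc m)
  have "poly p c = 0" using Suc.prems(2)[of 0] by simp
  then obtain q where q: "p = [:-c, 1:] * q"
    using poly_eq_0_iff_dvd dvdE by blast
  have deg: "degree q \<le> m"
  proof (cases "q = 0")
    case False
    then have "degree p = Suc (degree q)" unfolding q by (subst degree_mult_eq) auto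
    then show ?thesis using Suc.prems(1) by simp
  qed simp
  have "poly ((pderiv ^^ j) q) c = 0" if "j < m" for j
    using Suc.prems(2)[of "Suc j"] that unfolding q poly_higher_pderiv_linear_mult by simp
  then obtain e where "q = smult e ([:-c, 1:] ^ m)"
    using Suc.IH[OF deg] by blast
  then have "p = smult e ([:-c, 1:] ^ Suc m)" unfolding q power_Suc by (simp only: mult_smult_right)
  then show ?case by blast
qed

text \<open>Taylor polynomial built by Horner's scheme: the constant term carries
  \<open>d 0\<close>, the cofactor of \<open>x - c\<close> the shifted data. The division by
  \<open>Suc j\<close> offsets the factor that the shift produces.\<close>

lemma ex_poly_with_derivs:
  fixes d :: "nat \<Rightarrow> real"
  shows "\<exists>T. degree T \<le> m \<and> (\<forall>j<m. poly ((pderiv ^^ j) T) c = d j)"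
proof (induction m arbitrary: d)
  case 0
  show ?case by (intro exI[of _ 0]) simp
next
  case (Suc m)
  obtain T where T: "degree T \<le> m" "\<And>j. j < m \<Longrightarrow> poly ((pderiv ^^ j) T) c = d (Suc j) / of_nat (Suc j)"
    using Suc.IH[of "\<lambda>j. d (Suc j) / of_nat (Suc j)"] by blast
  let ?T = "[:d 0:] + [:-c, 1:] * T"
  have "degree ([:-c, 1:] * T) \<le> Suc m"
    using degree_mult_le[of "[:-c, 1:]" T] T(1) by simp
  then have "degree ?T \<le> Suc m" by (intro degree_add_le) auto
  moreover have "poly ((pderiv ^^ j) ?T) c = d j" if "j < Suc m" for j
  proof (cases j)
    case (Suc k)
    have "(pderiv ^^ Suc k) [:d 0:] = 0"
      unfolding funpow_Suc_right by (simp add: pderiv_pCons)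
    then have "poly ((pderiv ^^ Suc k) ?T) c = of_nat (Suc k) * poly ((pderiv ^^ k) T) c"
      unfolding higher_pderiv_add poly_add poly_higher_pderiv_linear_mult by simp
    then show ?thesis using T(2)[of k] that Suc by simp
  qed simp
  ultimately show ?case by blast
qed

text \<open>\<open>R\<close> is the piece on \<open>[u, z]\<close>, right of the knot
  \<open>u\<close>; \<open>L\<close> is the piece on \<open>[z, w]\<close>, left of the knot
  \<open>w\<close>. The \<open>p\<close> and \<open>q\<close> data leave each piece one free
  coefficient, matching the two conditions at \<open>z\<close>.\<close>

definition hermite_pair ::
  "real \<Rightarrow> real \<Rightarrow> real \<Rightarrow> nat \<Rightarrow> nat \<Rightarrow> (nat \<Rightarrow> real) \<Rightarrow> (nat \<Rightarrow> real) \<Rightarrow> real poly \<Rightarrow> real poly \<Rightarrow> bool" where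
  "hermite_pair u z w p q d e R L \<longleftrightarrow> degree R \<le> p \<and> degree L \<le> q \<and>
     (\<forall>j<p. poly ((pderiv ^^ j) R) u = d j) \<and> (\<forall>j<q. poly ((pderiv ^^ j) L) w = e j) \<and>
     (\<forall>j\<le>1. poly ((pderiv ^^ j) R) z = poly ((pderiv ^^ j) L) z)"

lemma hermite_pair_values:
  assumes "hermite_pair u z w p q d e R L"
  shows "p > 0 \<Longrightarrow> poly R u = d 0" and "q > 0 \<Longrightarrow> poly L w = e 0" and "poly R z = poly L z"
  using assms unfolding hermite_pair_def by (metis funpow_0 le0)+

text \<open>Superposition: every condition is linear in data and pieces jointly. This is what later
  allows all B-spline-like functions to be added up.\<close>

lemma hermite_pair_sum:
  assumes "\<And>k. k \<in> K \<Longrightarrow> hermite_pair u z w p q (d k) (e k) (R k) (L k)"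
  shows "hermite_pair u z w p q (\<lambda>j. \<Sum>k\<in>K. d k j) (\<lambda>j. \<Sum>k\<in>K. e k j) (\<Sum>k\<in>K. R k) (\<Sum>k\<in>K. L k)"
proof -
  \<comment> \<open>For infinite \<open>K\<close> the sums are 0 by convention, so the degree bounds
    hold in that case as well.\<close>
  have "degree (\<Sum>k\<in>K. R k) \<le> p" "degree (\<Sum>k\<in>K. L k) \<le> q"
    using assms unfolding hermite_pair_def by (metis degree_sum_le sum.infinite degree_0 le0)+
  then show ?thesis
    using assms unfolding hermite_pair_def by (auto simp: higher_pderiv_sum poly_sum intro!: sum.cong)
qed

text \<open>The determinant of the \<open>C\<^sup>1\<close> system, with \<open>h = z - u\<close> and \<open>\<kappa> = z - w\<close>.\<close>

lemma C1_det_nonzero: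
  fixes h \<kappa> :: real
  assumes "h > 0" "\<kappa> < 0"
  shows "h ^ Suc m * (real (Suc k) * \<kappa> ^ k) - real (Suc m) * h ^ m * \<kappa> ^ Suc k \<noteq> 0"
proof -
  have "real (Suc k) * h > 0" "real (Suc m) * \<kappa> < 0"
    using assms by (auto intro: mult_pos_pos mult_pos_neg)
  \<comment> \<open>This factor remains once \<open>h ^ m * \<kappa> ^ k\<close> is taken out of the
    determinant; the opposite signs of \<open>h\<close> and \<open>\<kappa>\<close> make it
    positive.\<close>
  then have "real (Suc k) * h - real (Suc m) * \<kappa> \<noteq> 0" by linarith
  then have "h ^ m * \<kappa> ^ k * (real (Suc k) * h - real (Suc m) * \<kappa>) \<noteq> 0" using assms by simp
  then show ?thesis by (simp add: algebra_simps)
qed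

text \<open>The unknown \<open>x\<close> stands last and the orders 0 and 1 stay explicit, so that
  the conditions at \<open>z\<close> turn directly into linear equations.\<close>

lemma poly_linear_power_derivs:
  fixes c :: real
  shows "poly ((pderiv ^^ 0) (smult x ([:-c, 1:] ^ Suc m))) z = (z - c) ^ Suc m * x"
    and "poly ((pderiv ^^ 1) (smult x ([:-c, 1:] ^ Suc m))) z = (real (Suc m) * (z - c) ^ m) * x"
proof -
  show "poly ((pderiv ^^ 0) (smult x ([:-c, 1:] ^ Suc m))) z = (z - c) ^ Suc m * x"
    by (simp add: poly_power del: power_Suc)
  have "pderiv [:-c, 1:] = 1" by (simp add: pderiv_pCons)
  then show "poly ((pderiv ^^ 1) (smult x ([:-c, 1:] ^ Suc m))) z = (real (Suc m) * (z - c) ^ m) * x"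
    by (simp add: pderiv_smult pderiv_power_Suc poly_power del: power_Suc of_nat_Suc)
qed

lemma all_le_1: "(\<forall>j\<le>1. P (j::nat)) \<longleftrightarrow> P 0 \<and> P 1"
  by (auto simp: le_Suc_eq)

text \<open>The differences of two solutions have zero data, hence are multiples of the two powers,
  and the homogeneous system at \<open>z\<close> admits only zero multiples.\<close>

lemma hermite_pair_unique:
  assumes "u < z" "z < w" "p > 0" "q > 0"
    and H: "hermite_pair u z w p q d e R L" "hermite_pair u z w p q d e R' L'"
  shows "R = R' \<and> L = L'"
proof -
  obtain m k where mk: "p = Suc m" "q = Suc k" using assms(3,4) by (meson gr0_implies_Suc)
  have diff: "(pderiv ^^ j) (A - B) = (pderiv ^^ j) A - (pderiv ^^ j) B" for j and A B :: "real poly"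
    using higher_pderiv_add[of j "A - B" B] by (simp add: algebra_simps)
  have "\<exists>x. R - R' = smult x ([:-u, 1:] ^ p)" "\<exists>y. L - L' = smult y ([:-w, 1:] ^ q)"
    using H by (intro vanishing_derivs_imp_linear_power; auto simp: hermite_pair_def diff intro: degree_diff_le)+
  then obtain x y where xy: "R - R' = smult x ([:-u, 1:] ^ Suc m)" "L - L' = smult y ([:-w, 1:] ^ Suc k)"
    using mk by blast
  have "poly ((pderiv ^^ j) (R - R')) z = poly ((pderiv ^^ j) (L - L')) z" if "j \<le> 1" for j
    using H that unfolding hermite_pair_def diff by simp
  from this[of 0] this[of 1]
  have eqs: "(z - u) ^ Suc m * x = (z - w) ^ Suc k * y"
     "real (Suc m) * (z - u) ^ m * x = real (Suc k) * (z - w) ^ k * y"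
    unfolding xy poly_linear_power_derivs by simp_all
  define A B A' B' where "A = (z - u) ^ Suc m" "B = (z - w) ^ Suc k"
    "A' = real (Suc m) * (z - u) ^ m" "B' = real (Suc k) * (z - w) ^ k"
  note D = this
  have det: "A * B' - A' * B \<noteq> 0"
    using C1_det_nonzero[of "z - u" "z - w" m k] assms(1,2) unfolding D by simp
  have "A * x = B * y" "A' * x = B' * y" using eqs unfolding D by simp_all
  then have "(A * B' - A' * B) * x = 0" "(A * B' - A' * B) * y = 0" by algebra+
  then have "x = 0" "y = 0" using det by simp_all
  then show ?thesis using xy by simp
qed

text \<open>Cramer's rule. The minus signs arise from moving the unknown multiple in
  \<open>L\<close> to the side of the one in \<open>R\<close>.\<close>

lemma cramer:
  fixes A B :: real
  assumes "A * B' - A' * B \<noteq> 0" (is "?D \<noteq> 0")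
  shows "\<exists>x y. A * x - B * y = r \<and> A' * x - B' * y = r'"
proof (intro exI conjI)
  let ?x = "(r * B' - r' * B) / ?D" and ?y = "(A' * r - A * r') / ?D"
  have lin: "P * (k / ?D) - Q * (l / ?D) = (P * k - Q * l) / ?D" for P Q k l
    by (simp add: diff_divide_distrib)
  have "A * ?x - B * ?y = (A * (r * B' - r' * B) - B * (A' * r - A * r')) / ?D"
    by (rule lin)
  also have "A * (r * B' - r' * B) - B * (A' * r - A * r') = r * ?D" by algebra
  finally show "A * ?x - B * ?y = r" using assms by simp
  have "A' * ?x - B' * ?y = (A' * (r * B' - r' * B) - B' * (A' * r - A * r')) / ?D"
    by (rule lin)
  also have "A' * (r * B' - r' * B) - B' * (A' * r - A * r') = r' * ?D" by algebra
  finally show "A' * ?x - B' * ?y = r'" using assms by simp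
qed

lemma hermite_pair_exists:
  assumes "u < z" "z < w" "p > 0" "q > 0"
  shows "\<exists>R L. hermite_pair u z w p q d e R L"
proof -
  obtain m k where mk: "p = Suc m" "q = Suc k" using assms(3,4) by (meson gr0_implies_Suc)
  obtain T where T: "degree T \<le> p" "\<And>j. j < p \<Longrightarrow> poly ((pderiv ^^ j) T) u = d j"
    using ex_poly_with_derivs[of p u d] by blast
  obtain V where V: "degree V \<le> q" "\<And>j. j < q \<Longrightarrow> poly ((pderiv ^^ j) V) w = e j"
    using ex_poly_with_derivs[of q w e] by blast
  define A B A' B' where "A = (z - u) ^ Suc m" "B = (z - w) ^ Suc k"
    "A' = real (Suc m) * (z - u) ^ m" "B' = real (Suc k) * (z - w) ^ k"
  note D = this
  have det: "A * B' - A' * B \<noteq> 0"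
    using C1_det_nonzero[of "z - u" "z - w" m k] assms(1,2) unfolding D by simp
  \<comment> \<open>The gaps in value and slope at \<open>z\<close> between the two Taylor
    polynomials; the added multiples have to close them without touching the data at
    \<open>u\<close> and \<open>w\<close>.\<close>
  define r r' where "r = poly ((pderiv ^^ 0) V) z - poly ((pderiv ^^ 0) T) z"
    "r' = poly ((pderiv ^^ 1) V) z - poly ((pderiv ^^ 1) T) z"
  note r = this
  obtain x y where sol: "A * x - B * y = r" "A' * x - B' * y = r'"
    using cramer[OF det] by blast
  define R L where "R = T + smult x ([:-u, 1:] ^ Suc m)" "L = V + smult y ([:-w, 1:] ^ Suc k)"
  note RL = this
  have deg: "degree (smult x ([:-c, 1:] ^ l)) \<le> l" for x c :: real and l
    by (metis degree_linear_power degree_smult_le)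
  have "degree R \<le> p" "degree L \<le> q" unfolding RL mk using T(1) V(1) mk deg
    by (auto intro!: degree_add_le simp del: power_Suc)
  moreover have "poly ((pderiv ^^ j) R) u = d j" if "j < p" for j
    using that T(2)[OF that] poly_higher_pderiv_linear_power[of j "Suc m" u] mk unfolding RL
    by (simp add: higher_pderiv_add higher_pderiv_smult del: power_Suc)
  moreover have "poly ((pderiv ^^ j) L) w = e j" if "j < q" for j
    using that V(2)[OF that] poly_higher_pderiv_linear_power[of j "Suc k" w] mk unfolding RL
    by (simp add: higher_pderiv_add higher_pderiv_smult del: power_Suc)
  moreover have "poly ((pderiv ^^ 0) R) z = poly ((pderiv ^^ 0) L) z"
    using sol(1) unfolding RL higher_pderiv_add poly_add poly_linear_power_derivs D[symmetric] r by simp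
  moreover have "poly ((pderiv ^^ 1) R) z = poly ((pderiv ^^ 1) L) z"
    using sol(2) unfolding RL higher_pderiv_add poly_add poly_linear_power_derivs D[symmetric] r by simp
  ultimately show ?thesis unfolding hermite_pair_def all_le_1 by blast
qed

section \<open>Derivatives of two polynomials glued at a point\<close>

lemma DERIV_glue_polys:
  fixes P Q :: "real poly"
  assumes "poly P c = poly Q c" "poly (pderiv P) c = poly (pderiv Q) c"
  shows "((\<lambda>x. if x \<le> c then poly P x else poly Q x) has_real_derivative
     (if x \<le> c then poly (pderiv P) x else poly (pderiv Q) x)) (at x)"
proof -
  \<comment> \<open>The closures of the two sides meet only at \<open>c\<close>, so values and
    slopes have to be compared there alone.\<close>
  have cl: "closure {..c} \<inter> closure {c<..} = {c}" by auto
  have "((\<lambda>x. if x \<in> {..c} then poly P x else poly Q x) has_vector_derivative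
     (if x \<in> {..c} then poly (pderiv P) x else poly (pderiv Q) x)) (at x within UNIV)"
    by (rule has_vector_derivative_If_within_closures[where T = "{c<..}"])
      (use assms in \<open>auto simp: has_real_derivative_iff_has_vector_derivative[symmetric]
          intro: DERIV_subset[OF poly_DERIV]\<close>)
  then show ?thesis by (simp add: has_real_derivative_iff_has_vector_derivative)
qed

text \<open>Stated on a relatively open part of \<open>{a..b}\<close> and not just at
  \<open>c\<close>, because differentiating once more at a point requires the previous derivative in
  a neighbourhood.\<close>

lemma nderiv_on_glued_polys:
  fixes P Q :: "real poly"
  assumes "a < b" "open U"
    and f: "\<And>x. x \<in> {a..b} \<inter> U \<Longrightarrow> f x = (if x \<le> c then poly P x else poly Q x)"
    and eq: "\<And>j. j \<le> m \<Longrightarrow> poly ((pderiv ^^ j) P) c = poly ((pderiv ^^ j) Q) c"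
  shows "j \<le> m \<Longrightarrow> x \<in> {a..b} \<inter> U \<Longrightarrow> nderiv_on {a..b} j f x =
     (if x \<le> c then poly ((pderiv ^^ j) P) x else poly ((pderiv ^^ j) Q) x)"
proof (induction j arbitrary: x)
  case 0
  then show ?case using f by simp
next
  case (Suc j)
  let ?g = "\<lambda>x. if x \<le> c then poly ((pderiv ^^ j) P) x else poly ((pderiv ^^ j) Q) x"
  let ?g' = "if x \<le> c then poly ((pderiv ^^ Suc j) P) x else poly ((pderiv ^^ Suc j) Q) x"
  have "(?g has_real_derivative ?g') (at x)"
    using DERIV_glue_polys[of "(pderiv ^^ j) P" c "(pderiv ^^ j) Q" x] eq[of j] eq[of "Suc j"] Suc.prems
    by (simp cong: if_cong split del: if_split)
  then have g: "(?g has_vector_derivative ?g') (at x within {a..b})"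
    by (simp add: has_real_derivative_iff_has_vector_derivative has_vector_derivative_at_within)
  obtain \<delta> where \<delta>: "\<delta> > 0" "\<And>y. dist y x < \<delta> \<Longrightarrow> y \<in> U"
    using Suc.prems(2) \<open>open U\<close> unfolding open_dist by blast
  have "(nderiv_on {a..b} j f has_vector_derivative ?g') (at x within {a..b})"
    by (rule has_vector_derivative_transform_within[OF g \<delta>(1)]) (use Suc \<delta> in auto)
  then have "nderiv_on {a..b} (Suc j) f x = ?g'"
    unfolding nderiv_on.simps
    using vector_derivative_within_closed_interval[OF \<open>a < b\<close>] Suc.prems(2) by blast
  then show ?case .
qed

subsection \<open>Splines through their pieces\<close>

locale knots =
  fixes n :: nat and v \<zeta> :: "nat \<Rightarrow> real" and \<phi> :: "nat \<Rightarrow> nat"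
  assumes n_pos: "n > 0"
    and zeta: "\<And>i. i < n \<Longrightarrow> v i < \<zeta> i \<and> \<zeta> i < v (Suc i)"
    and phi: "\<And>i. i \<le> n \<Longrightarrow> \<phi> i \<ge> 2"
begin

text \<open>Only the values are recorded here, interval by interval. A left piece is indexed by the
  knot at its right end, hence \<open>L (Suc i)\<close> on the interval that starts at
  \<open>v i\<close>.\<close>

definition piecewise :: "(real \<Rightarrow> real) \<Rightarrow> (nat \<Rightarrow> real poly) \<Rightarrow> (nat \<Rightarrow> real poly) \<Rightarrow> bool" where
  "piecewise s R L \<longleftrightarrow> (\<forall>i<n. (\<forall>x\<in>{v i..\<zeta> i}. s x = poly (R i) x) \<and>
     (\<forall>x\<in>{\<zeta> i..v (Suc i)}. s x = poly (L (Suc i)) x))"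

definition interpolates :: "(nat \<Rightarrow> nat \<Rightarrow> real) \<Rightarrow> (real \<Rightarrow> real) \<Rightarrow> bool" where
  "interpolates dat s \<longleftrightarrow> s \<in> spline_space n v \<zeta> \<phi> \<and>
     (\<forall>k\<le>n. \<forall>j\<le>\<phi> k - 1. nderiv_on {v 0..v n} j s (v k) = dat k j)"

abbreviation hermite_at :: "(nat \<Rightarrow> nat \<Rightarrow> real) \<Rightarrow> nat \<Rightarrow> real poly \<Rightarrow> real poly \<Rightarrow> bool" where
  "hermite_at dat i \<equiv>
     hermite_pair (v i) (\<zeta> i) (v (Suc i)) (\<phi> i) (\<phi> (Suc i)) (dat i) (dat (Suc i))"

lemma v_mono: "i \<le> j \<Longrightarrow> j \<le> n \<Longrightarrow> v i \<le> v j"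
proof (induction j rule: dec_induct)
  case (step j)
  then show ?case using zeta[of j] by fastforce
qed simp

lemma v0_less_vn: "v 0 < v n"
  using v_mono[of 1 n] zeta[of 0] n_pos by force

lemma split_pt_right: "i < n \<Longrightarrow> split_pt n v \<zeta> (int i) = \<zeta> i"
  by (simp add: split_pt_def)

lemma split_pt_left: "0 < i \<Longrightarrow> i \<le> n \<Longrightarrow> split_pt n v \<zeta> (int i - 1) = \<zeta> (i - 1)"
  by (auto simp: split_pt_def of_nat_diff nat_diff_distrib' intro: arg_cong[of _ _ \<zeta>])

lemma ex_knot_interval:
  assumes "x \<in> {v 0..v n}"
  shows "\<exists>i<n. x \<in> {v i..v (Suc i)}"
proof -
  have "x \<in> {v 0..v m} \<Longrightarrow> 0 < m \<Longrightarrow> \<exists>i<m. x \<in> {v i..v (Suc i)}" for m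
  proof (induction m)
    case (Suc m)
    show ?case
    proof (cases "x \<le> v m \<and> 0 < m")
      case True
      then show ?thesis using Suc by (meson atLeastAtMost_iff less_SucI)
    next
      case False
      then show ?thesis using Suc.prems by (intro exI[of _ m]) (auto simp: not_le)
    qed
  qed simp
  then show ?thesis using assms n_pos by blast
qed

lemma piecewise_cases:
  assumes "x \<in> {v 0..v n}" "piecewise s R L"
  obtains i where "i < n" "x \<in> {v i..\<zeta> i}" "s x = poly (R i) x"
  | i where "i < n" "x \<in> {\<zeta> i..v (Suc i)}" "s x = poly (L (Suc i)) x"
proof -
  obtain i where "i < n" "x \<in> {v i..v (Suc i)}" using ex_knot_interval assms by blast
  then show ?thesis using that[of i] assms(2) unfolding piecewise_def
    by (cases "x \<le> \<zeta> i") auto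
qed

text \<open>Translates the analytic derivatives in the definition of \<open>Nspline\<close> into
  formal derivatives of the pieces. The junction conditions enter because the derivative at an
  interior vertex is two-sided.\<close>

lemma nderiv_on_piecewise:
  assumes pw: "piecewise s R L"
    and junction: "\<And>i j. 0 < i \<Longrightarrow> i < n \<Longrightarrow> j \<le> \<phi> i - 1 \<Longrightarrow>
        poly ((pderiv ^^ j) (L i)) (v i) = poly ((pderiv ^^ j) (R i)) (v i)"
    and "i \<le> n" "j \<le> \<phi> i - 1"
  shows "i < n \<Longrightarrow> nderiv_on {v 0..v n} j s (v i) = poly ((pderiv ^^ j) (R i)) (v i)"
    and "0 < i \<Longrightarrow> nderiv_on {v 0..v n} j s (v i) = poly ((pderiv ^^ j) (L i)) (v i)"
proof -
  \<comment> \<open>At an end point, where only one piece exists, it is glued to itself.\<close>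
  define P where "P = (if i = 0 then R 0 else L i)"
  define Q where "Q = (if i = n then L n else R i)"
  \<comment> \<open>\<open>{lo<..<hi}\<close> is an open window around \<open>v i\<close> that meets
    no other pieces. At an end point it extends outwards by 1, and \<open>{v 0..v n}\<close> cuts
    the excess off.\<close>
  define lo where "lo = (if i = 0 then v 0 - 1 else \<zeta> (i - 1))"
  define hi where "hi = (if i = n then v n + 1 else \<zeta> i)"
  have lo: "lo < v i" using zeta[of "i - 1"] \<open>i \<le> n\<close> unfolding lo_def by auto
  have hi: "v i < hi" using zeta[of i] \<open>i \<le> n\<close> unfolding hi_def by auto
  have eq: "poly ((pderiv ^^ k) P) (v i) = poly ((pderiv ^^ k) Q) (v i)" if "k \<le> \<phi> i - 1" for k
    using junction[of i k] that \<open>i \<le> n\<close> n_pos unfolding P_def Q_def by auto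
  have vi: "v i \<in> {v 0..v n}" using v_mono \<open>i \<le> n\<close> by simp
  have s: "s x = (if x \<le> v i then poly P x else poly Q x)" if x: "x \<in> {v 0..v n} \<inter> {lo<..<hi}" for x
  proof (cases "x \<le> v i")
    case True
    show ?thesis
    proof (cases "i = 0")
      case i: True
      then have "x = v 0" using x True by simp
      then show ?thesis using pw zeta[of 0] n_pos i True unfolding piecewise_def P_def by force
    next
      case i: False
      then have "x \<in> {\<zeta> (i - 1)..v (Suc (i - 1))}" "i - 1 < n" using x True \<open>i \<le> n\<close> unfolding lo_def by auto
      then have "s x = poly (L (Suc (i - 1))) x" using pw unfolding piecewise_def by blast
      then show ?thesis using True i unfolding P_def by simp
    qed
  next
    case False
    then have "i \<noteq> n" using x by auto
    then have "x \<in> {v i..\<zeta> i}" "i < n" using x False \<open>i \<le> n\<close> unfolding hi_def by auto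
    then have "s x = poly (R i) x" using pw unfolding piecewise_def by blast
    then show ?thesis using False \<open>i \<noteq> n\<close> unfolding Q_def by simp
  qed
  have d: "nderiv_on {v 0..v n} j s (v i) = poly ((pderiv ^^ j) P) (v i)"
    using nderiv_on_glued_polys[where U = "{lo<..<hi}" and f = s and P = P and Q = Q and m = "\<phi> i - 1"
        and c = "v i" and x = "v i", OF v0_less_vn open_greaterThanLessThan s eq assms(4)] lo hi vi
    by simp
  show "i < n \<Longrightarrow> nderiv_on {v 0..v n} j s (v i) = poly ((pderiv ^^ j) (R i)) (v i)"
    using d eq[OF assms(4)] unfolding Q_def by simp
  show "0 < i \<Longrightarrow> nderiv_on {v 0..v n} j s (v i) = poly ((pderiv ^^ j) (L i)) (v i)"
    using d unfolding P_def by simp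
qed

lemma phi_le_iff: "k \<le> n \<Longrightarrow> j \<le> \<phi> k - 1 \<longleftrightarrow> j < \<phi> k"
  using phi[of k] by auto

text \<open>Reindexes left pieces by the interval they lie in, so that all conditions on one
  interval come under a single quantifier and \<open>split_pt\<close> reduces to
  \<open>\<zeta>\<close>.\<close>

lemma spline_space_iff:
  "s \<in> spline_space n v \<zeta> \<phi> \<longleftrightarrow> s \<in> extensional {v 0..v n} \<and> (\<exists>L R. piecewise s R L \<and>
     (\<forall>i<n. degree (R i) \<le> \<phi> i \<and> degree (L (Suc i)) \<le> \<phi> (Suc i) \<and>
        (\<forall>j\<le>1. poly ((pderiv ^^ j) (R i)) (\<zeta> i) = poly ((pderiv ^^ j) (L (Suc i))) (\<zeta> i))) \<and>
     (\<forall>i j. 0 < i \<and> i < n \<and> j \<le> \<phi> i - 1 \<longrightarrow>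
        poly ((pderiv ^^ j) (L i)) (v i) = poly ((pderiv ^^ j) (R i)) (v i)))"
proof -
  have all_pos: "(\<forall>i. 0 < i \<and> i \<le> n \<longrightarrow> P i) \<longleftrightarrow> (\<forall>i<n. P (Suc i))" for P
    by (metis Suc_le_eq Suc_pred zero_less_Suc)
  have L: "(\<forall>i. 0 < i \<and> i \<le> n \<longrightarrow> degree (L i) \<le> \<phi> i \<and>
        (\<forall>x \<in> {split_pt n v \<zeta> (int i - 1)..v i}. s x = poly (L i) x)) \<longleftrightarrow>
     (\<forall>i<n. degree (L (Suc i)) \<le> \<phi> (Suc i) \<and>
        (\<forall>x \<in> {\<zeta> i..v (Suc i)}. s x = poly (L (Suc i)) x))" for L
    unfolding all_pos using split_pt_left[of "Suc _"] by auto
  show ?thesis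
    unfolding spline_space_def piecewise_def mem_Collect_eq L
    by (rule conj_cong[OF refl], (rule ex_cong1)+, auto simp: split_pt_right)
qed

text \<open>With the data prescribed, smoothness at an interior vertex is automatic: both adjacent
  pieces have the same derivatives there. The problem thus splits into independent Hermite problems,
  one per interval.\<close>

lemma interpolates_iff:
  "interpolates dat s \<longleftrightarrow> s \<in> extensional {v 0..v n} \<and>
     (\<exists>R L. piecewise s R L \<and> (\<forall>i<n. hermite_at dat i (R i) (L (Suc i))))"
proof (intro iffI conjI)
  assume I: "interpolates dat s"
  then show "s \<in> extensional {v 0..v n}" unfolding interpolates_def spline_space_iff by blast
  obtain L R where LR: "piecewise s R L"
    "\<forall>i<n. degree (R i) \<le> \<phi> i \<and> degree (L (Suc i)) \<le> \<phi> (Suc i) \<and>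
        (\<forall>j\<le>1. poly ((pderiv ^^ j) (R i)) (\<zeta> i) = poly ((pderiv ^^ j) (L (Suc i))) (\<zeta> i))"
    "\<forall>i j. 0 < i \<and> i < n \<and> j \<le> \<phi> i - 1 \<longrightarrow>
        poly ((pderiv ^^ j) (L i)) (v i) = poly ((pderiv ^^ j) (R i)) (v i)"
    using I[unfolded interpolates_def spline_space_iff] by (elim conjE exE) (rule that)
  have junction: "\<And>i j. 0 < i \<Longrightarrow> i < n \<Longrightarrow> j \<le> \<phi> i - 1 \<Longrightarrow>
        poly ((pderiv ^^ j) (L i)) (v i) = poly ((pderiv ^^ j) (R i)) (v i)"
    using LR(3) by blast
  have "hermite_at dat i (R i) (L (Suc i))" if i: "i < n" for i
  proof -
    have "poly ((pderiv ^^ j) (R i)) (v i) = dat i j" if "j < \<phi> i" for j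
      using nderiv_on_piecewise(1)[OF LR(1) junction, of i j] I that i phi_le_iff[of i j]
      unfolding interpolates_def by auto
    moreover have "poly ((pderiv ^^ j) (L (Suc i))) (v (Suc i)) = dat (Suc i) j" if "j < \<phi> (Suc i)" for j
      using nderiv_on_piecewise(2)[OF LR(1) junction, of "Suc i" j] I that i phi_le_iff[of "Suc i" j]
      unfolding interpolates_def by auto
    ultimately show ?thesis using LR(2) i unfolding hermite_pair_def by blast
  qed
  then show "\<exists>R L. piecewise s R L \<and> (\<forall>i<n. hermite_at dat i (R i) (L (Suc i)))"
    using LR(1) by blast
next
  assume A: "s \<in> extensional {v 0..v n} \<and>
     (\<exists>R L. piecewise s R L \<and> (\<forall>i<n. hermite_at dat i (R i) (L (Suc i))))"
  then obtain R L where pw: "piecewise s R L" and H: "\<And>i. i < n \<Longrightarrow> hermite_at dat i (R i) (L (Suc i))"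
    by blast
  have R: "poly ((pderiv ^^ j) (R i)) (v i) = dat i j" if "i < n" "j \<le> \<phi> i - 1" for i j
    using H[OF that(1)] that phi_le_iff[of i j] unfolding hermite_pair_def by simp
  have L: "poly ((pderiv ^^ j) (L i)) (v i) = dat i j" if "0 < i" "i \<le> n" "j \<le> \<phi> i - 1" for i j
    using H[of "i - 1"] that phi_le_iff[of i j] unfolding hermite_pair_def by simp
  have junction: "poly ((pderiv ^^ j) (L i)) (v i) = poly ((pderiv ^^ j) (R i)) (v i)"
    if "0 < i" "i < n" "j \<le> \<phi> i - 1" for i j
    using R[of i j] L[of i j] that by simp
  have "s \<in> spline_space n v \<zeta> \<phi>"
    unfolding spline_space_iff using A pw H junction unfolding hermite_pair_def
    by (intro conjI exI[of _ L] exI[of _ R]) auto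
  moreover have "nderiv_on {v 0..v n} j s (v k) = dat k j" if "k \<le> n" "j \<le> \<phi> k - 1" for k j
    using nderiv_on_piecewise[OF pw junction that] R[of k j] L[of k j] that
    by (cases "k = 0") (use n_pos in auto)
  ultimately show "interpolates dat s" unfolding interpolates_def by blast
qed

text \<open>Agreement of values at all split points and interior vertices makes the pieces a
  well-defined function; the induction appends one interval at a time.\<close>

lemma ex_piecewise:
  assumes "\<And>i. i < n \<Longrightarrow> poly (R i) (\<zeta> i) = poly (L (Suc i)) (\<zeta> i)"
    and "\<And>i. 0 < i \<Longrightarrow> i < n \<Longrightarrow> poly (L i) (v i) = poly (R i) (v i)"
  shows "\<exists>s \<in> extensional {v 0..v n}. piecewise s R L"
proof -
  have "m \<le> n \<Longrightarrow> \<exists>s. \<forall>i<m. (\<forall>x\<in>{v i..\<zeta> i}. s x = poly (R i) x) \<and>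
     (\<forall>x\<in>{\<zeta> i..v (Suc i)}. s x = poly (L (Suc i)) x)" for m
  proof (induction m)
    case (Suc m)
    then obtain s where s: "\<And>i x. i < m \<Longrightarrow> x \<in> {v i..\<zeta> i} \<Longrightarrow> s x = poly (R i) x"
      "\<And>i x. i < m \<Longrightarrow> x \<in> {\<zeta> i..v (Suc i)} \<Longrightarrow> s x = poly (L (Suc i)) x" by force
    have m: "m < n" using Suc.prems by simp
    have at_vm: "s (v m) = poly (R m) (v m)" if "0 < m"
    proof -
      have "\<zeta> (m - 1) \<le> v m" using zeta[of "m - 1"] that m by force
      then show ?thesis using s(2)[of "m - 1" "v m"] assms(2)[of m] that m by simp
    qed
    \<comment> \<open>The guard \<open>0 < m\<close> sends \<open>v 0\<close> to the first piece
      when there is no earlier interval on which \<open>s\<close> is controlled.\<close>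
    define s' where "s' x = (if x \<le> v m \<and> 0 < m then s x else if x \<le> \<zeta> m then poly (R m) x
      else poly (L (Suc m)) x)" for x
    have "s' x = poly (R i) x" if "i < Suc m" "x \<in> {v i..\<zeta> i}" for i x
    proof (cases "i = m")
      case True
      then show ?thesis using that at_vm unfolding s'_def by auto
    next
      case False
      then have "i < m" "x \<le> v m" using that zeta[of i] v_mono[of "Suc i" m] m by auto
      then show ?thesis using s(1) that unfolding s'_def by auto
    qed
    moreover have "s' x = poly (L (Suc i)) x" if "i < Suc m" "x \<in> {\<zeta> i..v (Suc i)}" for i x
    proof (cases "i = m")
      case True
      then show ?thesis using that zeta[OF m] assms(1)[OF m] unfolding s'_def by auto
    next
      case False
      then have "i < m" "x \<le> v m" using that zeta[of i] v_mono[of "Suc i" m] m by auto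
      then show ?thesis using s(2) that unfolding s'_def by auto
    qed
    ultimately show ?case by blast
  qed simp
  then obtain s where "piecewise s R L" unfolding piecewise_def by blast
  moreover have "{v i..v (Suc i)} \<subseteq> {v 0..v n}" if "i < n" for i
    using v_mono[of 0 i] v_mono[of "Suc i" n] that by auto
  \<comment> \<open>Restriction makes the function extensional; all intervals lie in
    \<open>{v 0..v n}\<close>, so no value on them changes.\<close>
  ultimately have "piecewise (restrict s {v 0..v n}) R L"
    using zeta unfolding piecewise_def by (fastforce simp: subset_iff)
  then show ?thesis by (meson restrict_extensional)
qed

text \<open>Existence comes from solving on each interval and gluing; uniqueness from the uniqueness
  on each interval together with extensionality.\<close>

lemma interpolates_ex1: "\<exists>!s. interpolates dat s"
proof (rule ex_ex1I)
  have "\<forall>i. \<exists>R L. i < n \<longrightarrow> hermite_at dat i R L"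
    using hermite_pair_exists zeta phi by (metis Suc_leI less_imp_le pos2 order_less_le_trans)
  then obtain R L' where H: "\<And>i. i < n \<Longrightarrow> hermite_at dat i (R i) (L' i)" by metis
  \<comment> \<open>\<open>L'\<close> is indexed by intervals, \<open>L\<close> by right end knots,
    hence the shift.\<close>
  define L where "L i = L' (i - 1)" for i
  have H': "hermite_at dat i (R i) (L (Suc i))" if "i < n" for i
    using H that unfolding L_def by simp
  have "poly (R i) (\<zeta> i) = poly (L (Suc i)) (\<zeta> i)" if "i < n" for i
    using hermite_pair_values(3)[OF H'[OF that]] .
  moreover have "poly (L i) (v i) = poly (R i) (v i)" if "0 < i" "i < n" for i
    using hermite_pair_values(2)[OF H'[of "i - 1"]] hermite_pair_values(1)[OF H'[of i]] that phi[of i]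
    by simp
  ultimately obtain s where "s \<in> extensional {v 0..v n}" "piecewise s R L"
    using ex_piecewise by blast
  then show "\<exists>s. interpolates dat s" unfolding interpolates_iff using H' by blast
next
  fix s t assume "interpolates dat s" "interpolates dat t"
  then obtain R L R' L' where st: "s \<in> extensional {v 0..v n}" "t \<in> extensional {v 0..v n}"
    "piecewise s R L" "piecewise t R' L'"
    "\<And>i. i < n \<Longrightarrow> hermite_at dat i (R i) (L (Suc i)) \<and> hermite_at dat i (R' i) (L' (Suc i))"
    unfolding interpolates_iff by blast
  have eq: "R i = R' i \<and> L (Suc i) = L' (Suc i)" if "i < n" for i
    using hermite_pair_unique[of "v i" "\<zeta> i" "v (Suc i)" "\<phi> i" "\<phi> (Suc i)"] st(5)[OF that] that zeta[OF that]
      phi[of i] phi[of "Suc i"] by fastforce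
  show "s = t"
  proof (rule extensionalityI[OF st(1,2)])
    fix x assume "x \<in> {v 0..v n}"
    then show "s x = t x" using st(3)
      by (rule piecewise_cases) (use st(4) eq in \<open>auto simp: piecewise_def\<close>)
  qed
qed

text \<open>A single data table covers both clauses \<open>k = i\<close> and
  \<open>k \<noteq> i\<close>, so unique existence gives the definite description its
  meaning.\<close>

lemma interpolates_Nspline:
  assumes "i \<le> n"
  shows "interpolates (\<lambda>k j. if k = i then gamma_coeff n v \<zeta> \<phi> i \<alpha> j else 0) (Nspline n v \<zeta> \<phi> i \<alpha>)"
proof -
  let ?dat = "\<lambda>k j. if k = i then gamma_coeff n v \<zeta> \<phi> i \<alpha> j else 0"
  have "(\<lambda>s. s \<in> spline_space n v \<zeta> \<phi> \<and>
     (\<forall>j \<le> \<phi> i - 1. nderiv_on {v 0..v n} j s (v i) = gamma_coeff n v \<zeta> \<phi> i \<alpha> j) \<and>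
     (\<forall>k \<le> n. k \<noteq> i \<longrightarrow> (\<forall>j \<le> \<phi> k - 1. nderiv_on {v 0..v n} j s (v k) = 0))) = interpolates ?dat"
    unfolding interpolates_def using assms by (intro ext) auto
  then have "Nspline n v \<zeta> \<phi> i \<alpha> = (THE s. interpolates ?dat s)"
    unfolding Nspline_def by simp
  then show ?thesis using theI'[OF interpolates_ex1, of ?dat] by simp
qed

text \<open>Keeps the denominators of the Bernstein polynomials nonzero. The \<open>v i\<close>
  terms cancel in the difference, and since \<open>n > 0\<close> at most one side of
  \<open>v i\<close> is degenerate.\<close>

lemma S_left_less_S_right:
  assumes "i \<le> n"
  shows "S_left n v \<zeta> \<phi> i < S_right n v \<zeta> \<phi> i"
proof -
  have "split_pt n v \<zeta> (int i - 1) < split_pt n v \<zeta> (int i)"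
  proof (cases "i = 0")
    case True
    then show ?thesis using zeta[of 0] n_pos by (simp add: split_pt_def)
  next
    case i: False
    then have l: "split_pt n v \<zeta> (int i - 1) < v i"
      using split_pt_left[of i] zeta[of "i - 1"] assms by simp
    show ?thesis
    proof (cases "i = n")
      case True
      then show ?thesis using l by (simp add: split_pt_def)
    next
      case False
      then show ?thesis using l split_pt_right[of i] zeta[of i] assms by simp
    qed
  qed
  moreover have "theta \<phi> i > 0" using phi[OF assms] unfolding theta_def by simp
  ultimately show ?thesis unfolding S_left_def S_right_def by simp
qed

end

subsection \<open>Sums of Bernstein polynomials\<close>

lemma sum_pairs_eq:
  fixes f :: "nat \<times> nat \<Rightarrow> real"
  shows "(\<Sum>\<alpha> \<in> {\<alpha>. fst \<alpha> + snd \<alpha> = d}. f \<alpha>) = (\<Sum>k\<le>d. f (k, d - k))"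
  by (rule sum.reindex_bij_witness[of _ "\<lambda>k. (k, d - k)" fst]) auto

text \<open>A formal version, so that sums can be differentiated with \<open>pderiv\<close>, free of
  differentiability conditions.\<close>

definition bernstein_rpoly :: "nat \<times> nat \<Rightarrow> real \<Rightarrow> real \<Rightarrow> real poly" where
  "bernstein_rpoly \<alpha> A B =
     smult (fact (fst \<alpha> + snd \<alpha>) / (fact (fst \<alpha>) * fact (snd \<alpha>)) / (B - A) ^ (fst \<alpha> + snd \<alpha>))
       ([:B, -1:] ^ fst \<alpha> * [:-A, 1:] ^ snd \<alpha>)"

lemma bernstein_poly_eq: "bernstein_poly \<alpha> A B = poly (bernstein_rpoly \<alpha> A B)"
  unfolding bernstein_poly_def bernstein_rpoly_def by (intro ext) (simp add: poly_power)

text \<open>Binomial theorem for \<open>(B - x) + (x - A) = B - A\<close>.\<close>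

lemma sum_bernstein_poly:
  assumes "A \<noteq> B"
  shows "(\<Sum>\<alpha> \<in> {\<alpha>. fst \<alpha> + snd \<alpha> = d}. bernstein_poly \<alpha> A B x) = 1"
proof -
  have "(\<Sum>\<alpha> \<in> {\<alpha>. fst \<alpha> + snd \<alpha> = d}. bernstein_poly \<alpha> A B x) =
    (\<Sum>k\<le>d. of_nat (d choose k) * (B - x) ^ k * (x - A) ^ (d - k)) / (B - A) ^ d"
    unfolding sum_pairs_eq sum_divide_distrib
    by (intro sum.cong) (auto simp: bernstein_poly_def binomial_fact)
  also have "\<dots> = ((B - x) + (x - A)) ^ d / (B - A) ^ d"
    by (simp only: binomial_ring)
  finally show ?thesis using assms by simp
qed

lemma higher_deriv_poly: "(deriv ^^ j) (poly p) = poly ((pderiv ^^ j) (p :: real poly))"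
proof (induction j)
  case (Suc j)
  have "deriv (poly q) = poly (pderiv q)" for q :: "real poly"
    using DERIV_imp_deriv[OF poly_DERIV] by blast
  then show ?case using Suc by simp
qed simp

lemma higher_pderiv_1: "(pderiv ^^ j) 1 = (if j = 0 then 1 else 0)"
  by (cases j) (simp_all add: funpow_Suc_right del: funpow.simps)

lemma finite_pairs: "finite {\<alpha> :: nat \<times> nat. fst \<alpha> + snd \<alpha> = d}"
  by (rule finite_subset[of _ "{..d} \<times> {..d}"]) auto

section \<open>The partition of unity\<close>

context knots
begin

text \<open>The factor in front of the Bernstein derivative does not depend on
  \<open>\<alpha>\<close>, so the sum reaches the Bernstein polynomials, whose total is 1. For
  \<open>j = 0\<close> that factor is 1; for \<open>j > 0\<close> the derivative of 1
  vanishes.\<close>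

lemma sum_gamma_coeff:
  assumes "i \<le> n"
  shows "(\<Sum>\<alpha> \<in> {\<alpha>. fst \<alpha> + snd \<alpha> = d}. gamma_coeff n v \<zeta> \<phi> i \<alpha> j) = (if j = 0 then 1 else 0)"
proof -
  let ?A = "S_left n v \<zeta> \<phi> i" and ?B = "S_right n v \<zeta> \<phi> i"
  let ?I = "{\<alpha> :: nat \<times> nat. fst \<alpha> + snd \<alpha> = d}"
  let ?c = "real (\<phi> i choose j) / real ((\<phi> i - 1) choose j) * theta \<phi> i ^ j"
  have "poly (\<Sum>\<alpha>\<in>?I. bernstein_rpoly \<alpha> ?A ?B) = poly 1"
    using sum_bernstein_poly[where A = ?A and B = ?B and d = d] S_left_less_S_right[OF assms]
    by (intro ext) (simp add: poly_sum bernstein_poly_eq)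
  then have one: "(\<Sum>\<alpha>\<in>?I. bernstein_rpoly \<alpha> ?A ?B) = 1" by (simp add: poly_eq_poly_eq_iff)
  have "(\<Sum>\<alpha>\<in>?I. gamma_coeff n v \<zeta> \<phi> i \<alpha> j) =
     ?c * (\<Sum>\<alpha>\<in>?I. poly ((pderiv ^^ j) (bernstein_rpoly \<alpha> ?A ?B)) (v i))"
    unfolding gamma_coeff_def bernstein_poly_eq higher_deriv_poly sum_distrib_left by simp
  also have "\<dots> = ?c * poly ((pderiv ^^ j) (\<Sum>\<alpha>\<in>?I. bernstein_rpoly \<alpha> ?A ?B)) (v i)"
    by (simp only: higher_pderiv_sum poly_sum)
  finally show ?thesis unfolding one higher_pderiv_1 by simp
qed

lemma sum_Nspline:
  assumes "x \<in> {v 0..v n}"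
  shows "(\<Sum>i=0..n. \<Sum>\<alpha> \<in> {\<alpha>. fst \<alpha> + snd \<alpha> = \<phi> i - 1}. Nspline n v \<zeta> \<phi> i \<alpha> x) = 1"
proof -
  \<comment> \<open>The double sum is flattened to one index set of pairs, the form in which
    superposition applies.\<close>
  define K where "K = (SIGMA i:{0..n}. {\<alpha> :: nat \<times> nat. fst \<alpha> + snd \<alpha> = \<phi> i - 1})"
  define N where "N k = Nspline n v \<zeta> \<phi> (fst k) (snd k)" for k
  define dat where "dat k = (\<lambda>l j. if l = fst k then gamma_coeff n v \<zeta> \<phi> (fst k) (snd k) j else 0)" for k
  have double: "(\<Sum>i=0..n. \<Sum>\<alpha> \<in> {\<alpha>. fst \<alpha> + snd \<alpha> = \<phi> i - 1}. f i \<alpha>) = (\<Sum>k\<in>K. f (fst k) (snd k))"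
    for f :: "nat \<Rightarrow> nat \<times> nat \<Rightarrow> real"
    unfolding K_def by (subst sum.Sigma) (auto simp: finite_pairs case_prod_beta)
  have "interpolates (dat k) (N k)" if "k \<in> K" for k
    using interpolates_Nspline[of "fst k" "snd k"] that unfolding K_def N_def dat_def by auto
  then have "\<forall>k\<in>K. \<exists>R L. piecewise (N k) R L \<and> (\<forall>i<n. hermite_at (dat k) i (R i) (L (Suc i)))"
    by (simp add: interpolates_iff)
  then obtain R L where pw: "\<And>k. k \<in> K \<Longrightarrow> piecewise (N k) (R k) (L k)"
    and H: "\<And>k i. k \<in> K \<Longrightarrow> i < n \<Longrightarrow> hermite_at (dat k) i (R k i) (L k (Suc i))"
    by metis
  \<comment> \<open>At the vertex \<open>l\<close> only pairs with first component \<open>l\<close>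
    contribute; the total is the data of the constant 1.\<close>
  have dat_sum: "(\<Sum>k\<in>K. dat k l j) = (if j = 0 then 1 else 0)" if "l \<le> n" for l j
  proof -
    have "(\<Sum>k\<in>K. dat k l j) = (\<Sum>i=0..n. if l = i then
        (\<Sum>\<alpha> \<in> {\<alpha>. fst \<alpha> + snd \<alpha> = \<phi> i - 1}. gamma_coeff n v \<zeta> \<phi> i \<alpha> j) else 0)"
      unfolding dat_def
      by (subst double[of "\<lambda>i \<alpha>. if l = i then gamma_coeff n v \<zeta> \<phi> i \<alpha> j else 0", symmetric])
        (rule sum.cong, auto)
    then show ?thesis using sum_gamma_coeff[OF that] that by simp
  qed
  have sums: "(\<Sum>k\<in>K. R k i) = 1 \<and> (\<Sum>k\<in>K. L k (Suc i)) = 1" if "i < n" for i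
  proof -
    have "hermite_at (\<lambda>l j. \<Sum>k\<in>K. dat k l j) i (\<Sum>k\<in>K. R k i) (\<Sum>k\<in>K. L k (Suc i))"
      by (rule hermite_pair_sum) (rule H[OF _ that])
    \<comment> \<open>The constant 1 solves the same Hermite problem on this interval, so uniqueness
      identifies the summed pieces with it.\<close>
    moreover have "hermite_at (\<lambda>l j. \<Sum>k\<in>K. dat k l j) i 1 1"
      using that unfolding hermite_pair_def by (simp add: dat_sum higher_pderiv_1)
    ultimately show ?thesis
      using zeta[OF that] phi[of i] phi[of "Suc i"] that by (intro hermite_pair_unique) auto
  qed
  obtain i where i: "i < n" "x \<in> {v i..v (Suc i)}" using ex_knot_interval assms by blast
  have "(\<Sum>k\<in>K. N k x) = 1"
  proof (cases "x \<le> \<zeta> i")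
    case True
    then have "(\<Sum>k\<in>K. N k x) = (\<Sum>k\<in>K. poly (R k i) x)"
      using pw i unfolding piecewise_def by (intro sum.cong) auto
    also have "\<dots> = 1" using sums[OF i(1)] by (simp flip: poly_sum)
    finally show ?thesis .
  next
    case False
    then have "(\<Sum>k\<in>K. N k x) = (\<Sum>k\<in>K. poly (L k (Suc i)) x)"
      using pw i unfolding piecewise_def by (intro sum.cong) auto
    also have "\<dots> = 1" using sums[OF i(1)] by (simp flip: poly_sum)
    finally show ?thesis .
  qed
  then show ?thesis unfolding double N_def .
qed

end

theorem lemma6:
  fixes n :: nat and v \<zeta> :: "nat \<Rightarrow> real" and \<phi> :: "nat \<Rightarrow> nat" and a b :: real
  assumes "n \<ge> 1"
    and "v 0 = a" and "v n = b"
    and "\<And>i. i < n \<Longrightarrow> v i < v (Suc i)"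
    and "\<And>i. i < n \<Longrightarrow> \<zeta> i \<in> {v i<..<v (Suc i)}"
    and "\<And>i. i \<le> n \<Longrightarrow> \<phi> i \<ge> 2"
  shows "\<forall>x \<in> {a..b}.
    (\<Sum>i=0..n. \<Sum>\<alpha> \<in> {\<alpha>. fst \<alpha> + snd \<alpha> = \<phi> i - 1}. Nspline n v \<zeta> \<phi> i \<alpha> x) = 1"
proof -
  interpret knots n v \<zeta> \<phi> using assms by unfold_locales auto
  show ?thesis using sum_Nspline assms(2,3) by blast
qed

end
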